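(* Let $\varepsilon\in\{1,-1\}$, let $$L=q^{-k}(1+q^{k+1})[k+2]\,\sigma^2+\varepsilon\,(q+q^{k+2}+q^{2k+4}+3q^{k+3})[-2k-3]\,\sigma+q^{-k}(1+q^{k+2})[k+1],$$ and let $n$ be a positive integer. For any Laurent polynomial $p(x)\in\mathbb{K}(q)[x,x^{-1}]$, writing $P(k)=p(q^k)$ for $k\in\mathbb{Z}$, we have $$\sum_{k=0}^{n-1}(L^{\ast}P)(k)\,\varepsilon^kD_k(q)=\varepsilon^{n}[n]\,q^{1-n}\Big((1+q^{n+1})\,P(n-1)\,\varepsilon D_{n-1}(q)-q(1+q^{n-1})\,P(n-2)\,D_n(q)\Big).$$
   Context: $\mathbb{K}$ is a field of characteristic zero, $q$ an indeterminate, $\sigma$ the shift operator in $k$, and $[m]=\frac{1-q^m}{1-q}$ for $m\in\mathbb{Z}$. For an operator $L=\sum_{i=0}^{J}a_i(k)\sigma^i$ whose coefficients $a_i(k)$ are Laurent polynomials in $q^k$ over $\mathbb{K}(q)$, the adjoint is $(L^{\ast}P)(k)=\sum_{i=0}^{J}a_i(k-i)P(k-i)$. The $q$-binomial coefficient is $\left[\begin{matrix}m\\ k\end{matrix}\right]=\frac{\prod_{1\le j\le k}[m-j+1]}{\prod_{1\le j\le k}[j]}$ for $k\ge1$, $\left[\begin{matrix}m\\0\end{matrix}\right]=1$. The $q$-central Delannoy numbers are $D_n(q)=\sum_{k=0}^{n}q^{\binom{k}{2}-kn}\left[\begin{matrix}n\\k\end{matrix}\right]\left[\begin{matrix}n+k\\k\end{matrix}\right]$.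 *)

theory Defs
  imports
    "HOL-Computational_Algebra.Polynomial"
    "HOL-Computational_Algebra.Fraction_Field"
    "HOL-Library.Poly_Mapping"
begin

text \<open>The field \<open>K(q)\<close> is \<^typ>\<open>'k poly fract\<close>; the indeterminate is the image of the
  polynomial variable.\<close>

definition q :: "'k::field_char_0 poly fract" where
  "q = Fraction_Field.Fract [:0, 1:] 1"

definition q_int :: "int \<Rightarrow> 'k::field_char_0 poly fract" where
  "q_int m = (1 - q powi m) / (1 - q)"

text \<open>For \<open>k = 0\<close> both products are empty, so the value is 1.\<close>

definition q_binomial :: "int \<Rightarrow> nat \<Rightarrow> 'k::field_char_0 poly fract" where
  "q_binomial m k = (\<Prod>j=1..k. q_int (m - int j + 1)) / (\<Prod>j=1..k. q_int (int j))"

definition q_delannoy :: "nat \<Rightarrow> 'k::field_char_0 poly fract" where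
  "q_delannoy n =
     (\<Sum>k=0..n. q powi (int (k choose 2) - int k * int n)
        * q_binomial (int n) k * q_binomial (int n + int k) k)"

text \<open>Laurent polynomials over \<open>c\<close> as the group ring of the integers: finitely supported
  maps from exponents to coefficients, with convolution as multiplication.\<close>

type_synonym 'c laurent_poly = "int \<Rightarrow>\<^sub>0 'c"

definition laurent_eval :: "'c::field laurent_poly \<Rightarrow> 'c \<Rightarrow> 'c" where
  "laurent_eval p x = (\<Sum>i\<in>Poly_Mapping.keys p. Poly_Mapping.lookup p i * x powi i)"

text \<open>A difference operator \<open>a\<^sub>0(k) + a\<^sub>1(k) \<sigma> + \<dots> + a\<^sub>J(k) \<sigma>\<^sup>J\<close> is represented by the list
  \<open>[a\<^sub>0, \<dots>, a\<^sub>J]\<close> of its coefficient functions. The formula for the adjoint makes sense for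
  arbitrary coefficients, so they are not restricted to Laurent polynomials in \<open>q\<^sup>k\<close>.\<close>

type_synonym 'c diff_op = "(int \<Rightarrow> 'c) list"

definition adjoint :: "'c::field diff_op \<Rightarrow> (int \<Rightarrow> 'c) \<Rightarrow> int \<Rightarrow> 'c" where
  "adjoint L P k = (\<Sum>i<length L. (L ! i) (k - int i) * P (k - int i))"

definition delannoy_op :: "'k::field_char_0 poly fract \<Rightarrow> 'k poly fract diff_op" where
  "delannoy_op \<epsilon> =
     [\<lambda>k. q powi (- k) * (1 + q powi (k + 2)) * q_int (k + 1),
      \<lambda>k. \<epsilon> * (q + q powi (k + 2) + q powi (2 * k + 4) + 3 * q powi (k + 3)) * q_int (- 2 * k - 3),
      \<lambda>k. q powi (- k) * (1 + q powi (k + 1)) * q_int (k + 2)]"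

end

theory Submission
  imports Defs
begin

text \<open>
  The operator \<open>L\<close> is chosen so that it annihilates \<open>F(k) = \<epsilon>\<^sup>k D\<^sub>k(q)\<close>; its equation is the
  three-term recurrence of the \<open>q\<close>-central Delannoy numbers. Summation by parts turns
  \<open>\<Sum>k<n. (L\<^sup>*P)(k) F(k)\<close> into \<open>\<Sum>k<n. P(k) (LF)(k)\<close>, which vanishes, plus boundary terms. The
  boundary terms at the lower end also vanish: the coefficient of \<open>\<sigma>\<^sup>2\<close> at \<open>k = -2\<close> contains the
  factor \<open>[0]\<close>, and so does that of \<open>\<sigma>\<^sup>0\<close> at \<open>k = -1\<close>, where the other two terms cancel. The terms at
  the upper end are the right-hand side. The summation is carried out by induction on \<open>n\<close>
  in \<open>sum_adjoint_delannoy_op\<close>.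

  The recurrence (\<open>q_delannoy_recurrence\<close>) follows by creative telescoping. With \<open>Q = q\<^sup>n\<close> and
  \<open>z = q\<^sup>k\<close>, the \<open>k\<close>-th summands of \<open>D\<^sub>n\<close>, \<open>D\<^sub>n\<^sub>+\<^sub>1\<close> and \<open>D\<^sub>n\<^sub>+\<^sub>2\<close> are, up to one factor that does
  not depend on \<open>k\<close>, polynomials in \<open>Q\<close> and \<open>1/z\<close>, \<open>z\<close> times a common hypergeometric term
  \<open>u\<^sub>k\<close> (\<open>delannoy_terms_via_common_term\<close>). The combination of summands prescribed by the
  recurrence is then \<open>G(k+1) - G(k)\<close> with \<open>G(k) = \<alpha> (1 - z)\<^sup>2 u\<^sub>k / z\<^sup>2\<close> for some \<open>\<alpha>\<close> depending
  only on \<open>q\<close> and \<open>Q\<close>. This is an identity of rational functions in \<open>q\<close>, \<open>Q\<close>, \<open>z\<close>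
  (\<open>certificate_identity\<close>), and \<open>G\<close> vanishes at both ends of the summation range.
\<close>

section \<open>The indeterminate and \<open>q\<close>-binomial coefficients\<close>

lemma q_power: "(q :: 'k::field_char_0 poly fract) ^ m = Fract (monom 1 m) 1"
proof (induction m)
  case 0
  show ?case by (simp add: One_fract_def monom_0 pCons_one)
next
  case (Suc m)
  have "(q :: 'k poly fract) ^ Suc m = q * Fract (monom 1 m) 1"
    by (simp add: Suc)
  then show ?case by (simp add: q_def monom_Suc)
qed

lemma q_nonzero [simp]: "(q :: 'k::field_char_0 poly fract) \<noteq> 0"
  by (simp add: q_def Zero_fract_def eq_fract)

lemma q_power_neq_one: "m > 0 \<Longrightarrow> (q :: 'k::field_char_0 poly fract) ^ m \<noteq> 1"
proof
  assume "m > 0" and "(q :: 'k poly fract) ^ m = 1"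
  then have "monom (1::'k) m = 1"
    by (simp add: q_power One_fract_def eq_fract)
  then have "degree (monom (1::'k) m) = 0" by simp
  with \<open>m > 0\<close> show False by (simp add: degree_monom_eq)
qed

lemma one_minus_q_power_Suc_nonzero:
  "1 - q * q ^ m \<noteq> (0 :: 'k::field_char_0 poly fract)"
  using q_power_neq_one[of "Suc m"] by auto

lemma one_minus_q_nonzero: "1 - q \<noteq> (0 :: 'k::field_char_0 poly fract)"
  using one_minus_q_power_Suc_nonzero[of 0] by simp

lemma q_binomial_0: "q_binomial m 0 = 1"
  by (simp add: q_binomial_def)

lemma q_binomial_Suc:
  "q_binomial m (Suc k) = q_binomial m k * (1 - q powi (m - int k)) / (1 - q * q ^ k)"
proof -
  have "q_binomial m (Suc k) = q_binomial m k * (q_int (m - int k) / q_int (int (Suc k)))"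
    by (simp add: q_binomial_def)
  also have "q_int (m - int k) / q_int (int (Suc k))
      = (1 - q powi (m - int k)) / (1 - q * (q :: 'a poly fract) ^ k)"
    using one_minus_q_nonzero[where 'k='a]
    by (simp only: q_int_def power_int_of_nat power_Suc) simp
  finally show ?thesis by simp
qed

text \<open>Both sides are \<open>(1 - q\<^sup>m\<^sup>+\<^sup>1) (1 - q\<^sup>m) \<dots> (1 - q\<^sup>m\<^sup>+\<^sup>1\<^sup>-\<^sup>k)\<close> over the same denominator. The
  product form avoids any case distinction when one of the factors is zero.\<close>

lemma q_binomial_shift_top:
  "q_binomial (m + 1) k * (1 - q powi (m + 1 - int k)) = q_binomial m k * (1 - q powi (m + 1))"
proof (induction k)
  case 0
  show ?case by (simp add: q_binomial_0)
next
  case (Suc k)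
  have "q_binomial (m + 1) (Suc k) * (1 - q powi (m + 1 - int (Suc k)))
      = q_binomial (m + 1) k * (1 - q powi (m + 1 - int k)) / (1 - q * (q :: 'a poly fract) ^ k)
        * (1 - q powi (m - int k))"
    by (simp add: q_binomial_Suc)
  also have "\<dots> = q_binomial m (Suc k) * (1 - q powi (m + 1))"
    by (simp add: Suc q_binomial_Suc)
  finally show ?case .
qed

lemma q_binomial_absorption:
  "q_binomial (m + 1) (Suc k) = q_binomial m k * (1 - q powi (m + 1)) / (1 - q * q ^ k)"
  by (simp add: q_binomial_Suc q_binomial_shift_top)

lemma q_binomial_eq_0: "k > n \<Longrightarrow> q_binomial (int n) k = 0"
  by (auto simp: q_binomial_def q_int_def intro!: prod_zero bexI[of _ "Suc n"])

section \<open>A common hypergeometric term\<close>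

definition delannoy_term :: "nat \<Rightarrow> nat \<Rightarrow> 'k::field_char_0 poly fract" where
  "delannoy_term n k = q powi (int (k choose 2) - int k * int n)
     * q_binomial (int n) k * q_binomial (int n + int k) k"

text \<open>Summands beyond the \<open>n\<close>-th vanish, so that \<open>D\<^sub>n\<close>, \<open>D\<^sub>n\<^sub>+\<^sub>1\<close> and \<open>D\<^sub>n\<^sub>+\<^sub>2\<close> can be summed over
  the same range.\<close>

lemma q_delannoy_eq_sum_terms:
  assumes "m > n"
  shows "q_delannoy n = (\<Sum>k<m. delannoy_term n k)"
proof -
  have "q_delannoy n = (\<Sum>k=0..n. delannoy_term n k)"
    by (simp add: q_delannoy_def delannoy_term_def)
  also have "\<dots> = (\<Sum>k<m. delannoy_term n k)"
    using assms by (intro sum.mono_neutral_left) (auto simp: delannoy_term_def q_binomial_eq_0)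
  finally show ?thesis .
qed

text \<open>The first \<open>q\<close>-binomial coefficient is taken from the summand of \<open>D\<^sub>n\<^sub>+\<^sub>2\<close> and the second, like
  the power of \<open>q\<close>, from that of \<open>D\<^sub>n\<close>. With this mixture the factors that relate it to the three
  summands have no denominator that vanishes for some \<open>k\<close>, such as \<open>1 - q\<^sup>n\<^sup>+\<^sup>1\<^sup>-\<^sup>k\<close>.\<close>

definition common_term :: "nat \<Rightarrow> nat \<Rightarrow> 'k::field_char_0 poly fract" where
  "common_term n k = q powi (int (k choose 2) - int k * int n)
     * q_binomial (int n + 2) k * q_binomial (int n + int k) k"

text \<open>Raising \<open>n\<close> by one divides the power of \<open>q\<close> by \<open>z\<close>, and \<open>q_binomial_shift_top\<close> exchanges
  one factor in each \<open>q\<close>-binomial coefficient.\<close>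

lemma delannoy_terms_via_common_term:
  fixes n k :: nat
  defines "Q \<equiv> (q :: 'k::field_char_0 poly fract) ^ n" and "z \<equiv> (q :: 'k poly fract) ^ k"
    and "u \<equiv> (common_term n k :: 'k poly fract)"
  shows "(1 - Q * q) * (1 - Q * q\<^sup>2) * delannoy_term n k = u * (1 - Q * q / z) * (1 - Q * q\<^sup>2 / z)"
    and "(1 - Q * q) * (1 - Q * q\<^sup>2) * delannoy_term (n + 1) k = u * (1 - Q * q\<^sup>2 / z) * (1 - Q * q * z) / z"
    and "(1 - Q * q) * (1 - Q * q\<^sup>2) * delannoy_term (n + 2) k = u * (1 - Q * q * z) * (1 - Q * q\<^sup>2 * z) / z\<^sup>2"
proof -
  define N where "N = (1 - Q * q) * (1 - Q * q\<^sup>2)"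
  define w where "w = (q :: 'k poly fract) powi (int (k choose 2) - int k * int n)"
  have w1: "q powi (int (k choose 2) - int k * int (n + 1)) = w / z"
  proof -
    have "int (k choose 2) - int k * int (n + 1) = (int (k choose 2) - int k * int n) - int k"
      by (simp add: algebra_simps)
    then show ?thesis by (simp only: power_int_diff w_def z_def q_nonzero power_int_of_nat not_False_eq_True simp_thms)
  qed
  have w2: "q powi (int (k choose 2) - int k * int (n + 2)) = w / z\<^sup>2"
  proof -
    have "int (k choose 2) - int k * int (n + 2) = (int (k choose 2) - int k * int n) - int k - int k"
      by (simp add: algebra_simps)
    then show ?thesis by (simp only: power_int_diff w_def z_def q_nonzero power_int_of_nat simp_thms)
        (simp add: power2_eq_square)
  qed
  have fall1: "q_binomial (int n + 1) k * (1 - Q * q / z) = q_binomial (int n) k * (1 - Q * q)"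
    using q_binomial_shift_top[of "int n" k, where 'a='k]
    by (simp add: power_int_diff power_int_add Q_def z_def)
  have fall2: "q_binomial (int n + 2) k * (1 - Q * q\<^sup>2 / z) = q_binomial (int n + 1) k * (1 - Q * q\<^sup>2)"
    using q_binomial_shift_top[of "int n + 1" k, where 'a='k]
    by (simp add: add.commute[of 2] power_int_diff power_int_add Q_def z_def power2_eq_square mult.assoc)
  have rise1: "q_binomial (int n + 1 + int k) k * (1 - Q * q) = q_binomial (int n + int k) k * (1 - Q * q * z)"
    using q_binomial_shift_top[of "int n + int k" k, where 'a='k]
    by (simp add: power_int_diff power_int_add Q_def z_def ac_simps)
  have rise2: "q_binomial (int n + 2 + int k) k * (1 - Q * q\<^sup>2) = q_binomial (int n + 1 + int k) k * (1 - Q * q\<^sup>2 * z)"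
    using q_binomial_shift_top[of "int n + 1 + int k" k, where 'a='k]
    by (simp add: power_int_diff power_int_add Q_def z_def ac_simps power2_eq_square)
  have t0: "delannoy_term n k = w * q_binomial (int n) k * q_binomial (int n + int k) k"
    by (simp add: delannoy_term_def w_def)
  have t1: "delannoy_term (n + 1) k = w / z * q_binomial (int n + 1) k * q_binomial (int n + 1 + int k) k"
    unfolding delannoy_term_def w1 by (simp add: ac_simps)
  have t2: "delannoy_term (n + 2) k = w / z\<^sup>2 * q_binomial (int n + 2) k * q_binomial (int n + 2 + int k) k"
    unfolding delannoy_term_def w2 by (simp add: ac_simps)
  have u: "u = w * q_binomial (int n + 2) k * q_binomial (int n + int k) k"
    by (simp add: u_def common_term_def w_def)
  have "N * delannoy_term n k
      = w * q_binomial (int n + int k) k * (1 - Q * q\<^sup>2) * (q_binomial (int n) k * (1 - Q * q))"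
    unfolding t0 N_def by (simp only: ac_simps)
  also have "\<dots> = w * q_binomial (int n + int k) k * (1 - Q * q / z) * (q_binomial (int n + 1) k * (1 - Q * q\<^sup>2))"
    unfolding fall1[symmetric] by (simp only: ac_simps)
  also have "\<dots> = u * (1 - Q * q / z) * (1 - Q * q\<^sup>2 / z)"
    unfolding fall2[symmetric] u by (simp only: ac_simps)
  finally show "(1 - Q * q) * (1 - Q * q\<^sup>2) * delannoy_term n k = u * (1 - Q * q / z) * (1 - Q * q\<^sup>2 / z)"
    unfolding N_def .
  have "N * delannoy_term (n + 1) k
      = w / z * (q_binomial (int n + 1) k * (1 - Q * q\<^sup>2)) * (q_binomial (int n + 1 + int k) k * (1 - Q * q))"
    unfolding t1 N_def by (simp only: ac_simps)
  also have "\<dots> = u * (1 - Q * q\<^sup>2 / z) * (1 - Q * q * z) / z"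
    unfolding rise1 fall2[symmetric] u by simp
  finally show "(1 - Q * q) * (1 - Q * q\<^sup>2) * delannoy_term (n + 1) k = u * (1 - Q * q\<^sup>2 / z) * (1 - Q * q * z) / z"
    unfolding N_def .
  have "N * delannoy_term (n + 2) k
      = w / z\<^sup>2 * q_binomial (int n + 2) k * (1 - Q * q) * (q_binomial (int n + 2 + int k) k * (1 - Q * q\<^sup>2))"
    unfolding t2 N_def by (simp only: ac_simps)
  also have "\<dots> = w / z\<^sup>2 * q_binomial (int n + 2) k * (1 - Q * q\<^sup>2 * z) * (q_binomial (int n + 1 + int k) k * (1 - Q * q))"
    unfolding rise2 by (simp only: ac_simps)
  also have "\<dots> = u * (1 - Q * q * z) * (1 - Q * q\<^sup>2 * z) / z\<^sup>2"
    unfolding rise1 u by simp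
  finally show "(1 - Q * q) * (1 - Q * q\<^sup>2) * delannoy_term (n + 2) k = u * (1 - Q * q * z) * (1 - Q * q\<^sup>2 * z) / z\<^sup>2"
    unfolding N_def .
qed

lemma common_term_Suc:
  fixes n k :: nat
  defines "Q \<equiv> (q :: 'k::field_char_0 poly fract) ^ n" and "z \<equiv> (q :: 'k poly fract) ^ k"
  shows "(1 - q * z)\<^sup>2 * common_term n (Suc k)
    = common_term n k * (z / Q) * (1 - Q * q\<^sup>2 / z) * (1 - Q * q * z)"
proof -
  have "int (Suc k choose 2) - int (Suc k) * int n = (int (k choose 2) - int k * int n) + int k - int n"
    by (simp add: choose_two numeral_2_eq_2 algebra_simps)
  then have w: "(q :: 'k poly fract) powi (int (Suc k choose 2) - int (Suc k) * int n)
      = q powi (int (k choose 2) - int k * int n) * z / Q"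
    by (simp only: power_int_diff power_int_add Q_def z_def q_nonzero power_int_of_nat simp_thms)
  have fall: "q_binomial (int n + 2) (Suc k)
      = q_binomial (int n + 2) k * (1 - Q * q\<^sup>2 / z) / (1 - q * z)"
    by (simp add: q_binomial_Suc power_int_diff power_int_add Q_def z_def)
  have rise: "q_binomial (int n + int (Suc k)) (Suc k)
      = q_binomial (int n + int k) k * (1 - Q * q * z) / (1 - q * z)"
    using q_binomial_absorption[of "int n + int k" k, where 'a='k]
    by (simp add: power_int_add Q_def z_def ac_simps)
  have "1 - q * z \<noteq> 0"
    by (simp add: z_def one_minus_q_power_Suc_nonzero del: right_minus_eq)
  then show ?thesis
    unfolding common_term_def w fall rise by (simp add: power2_eq_square)
qed

section \<open>The recurrence of the Delannoy numbers\<close>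

text \<open>This is the telescoping relation divided by \<open>u\<^sub>k\<close>. The factor \<open>(1 - z)\<^sup>2\<close> of \<open>G(k)\<close> cancels the
  denominator of \<open>u\<^sub>k\<^sub>+\<^sub>1 / u\<^sub>k\<close>, and \<open>1 / z\<^sup>2\<close> makes the powers of \<open>z\<close> on both sides range from \<open>-2\<close> to
  \<open>0\<close>. The value of \<open>\<alpha>\<close> comes from comparing the coefficients of \<open>1 / z\<^sup>2\<close>, which on the right is
  \<open>-2 \<alpha>\<close>. The coefficients on the left are those of \<open>L\<close> at \<open>k = n\<close> (with \<open>\<epsilon>\<close>
  removed), multiplied by \<open>Q\<^sup>2 q\<^sup>3 (1 - q)\<close> to clear denominators.\<close>

lemma certificate_identity:
  fixes q Q z :: "'a::field"
  assumes "q \<noteq> 0" "Q \<noteq> 0" "z \<noteq> 0"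
  defines "\<alpha> \<equiv> (Q\<^sup>2 * q ^ 3 - 1) * (1 + Q * q) * (1 + Q * q\<^sup>2) * Q * q ^ 3"
  shows "Q * q ^ 3 * (1 + Q * q) * (1 - Q * q\<^sup>2) * ((1 - Q * q * z) * (1 - Q * q\<^sup>2 * z) / z\<^sup>2)
      + (q + Q * q\<^sup>2 + Q\<^sup>2 * q ^ 4 + 3 * Q * q ^ 3) * (Q\<^sup>2 * q ^ 3 - 1)
          * ((1 - Q * q\<^sup>2 / z) * (1 - Q * q * z) / z)
      + Q * q ^ 3 * (1 + Q * q\<^sup>2) * (1 - Q * q) * ((1 - Q * q / z) * (1 - Q * q\<^sup>2 / z))
    = \<alpha> / (q * z)\<^sup>2 * ((z / Q) * (1 - Q * q\<^sup>2 / z) * (1 - Q * q * z)) - \<alpha> / z\<^sup>2 * (1 - z)\<^sup>2"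
  unfolding \<alpha>_def using assms(1-3)
  by (simp add: divide_simps) algebra

lemma q_delannoy_recurrence:
  fixes n :: nat
  defines "Q \<equiv> (q :: 'k::field_char_0 poly fract) ^ n"
  shows "Q * q ^ 3 * (1 + Q * q) * (1 - Q * q\<^sup>2) * q_delannoy (n + 2)
      + (q + Q * q\<^sup>2 + Q\<^sup>2 * q ^ 4 + 3 * Q * q ^ 3) * (Q\<^sup>2 * q ^ 3 - 1) * q_delannoy (n + 1)
      + Q * q ^ 3 * (1 + Q * q\<^sup>2) * (1 - Q * q) * q_delannoy n = 0"
    (is "?A * _ + ?B * _ + ?C * _ = 0")
proof -
  define N where "N = (1 - Q * q) * (1 - Q * q\<^sup>2)"
  define \<alpha> where "\<alpha> = (Q\<^sup>2 * q ^ 3 - 1) * (1 + Q * q) * (1 + Q * q\<^sup>2) * Q * q ^ 3"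
  define G where "G k = \<alpha> / (q ^ k)\<^sup>2 * (1 - q ^ k)\<^sup>2 * common_term n k" for k
  have "N \<noteq> 0"
    using one_minus_q_power_Suc_nonzero[of n, where 'k='k]
      one_minus_q_power_Suc_nonzero[of "n + 1", where 'k='k]
    by (simp add: N_def Q_def power2_eq_square ac_simps del: right_minus_eq)
  have step: "N * (?A * delannoy_term (n + 2) k + ?B * delannoy_term (n + 1) k + ?C * delannoy_term n k)
      = G (Suc k) - G k" for k
  proof -
    define z u where "z = (q :: 'k poly fract) ^ k" and "u = (common_term n k :: 'k poly fract)"
    have "z \<noteq> 0" "Q \<noteq> 0" by (simp_all add: z_def Q_def)
    note terms = delannoy_terms_via_common_term[where n=n and k=k and 'k='k,
        folded Q_def z_def u_def, folded N_def]
    have "N * (?A * delannoy_term (n + 2) k + ?B * delannoy_term (n + 1) k + ?C * delannoy_term n k)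
        = ?A * (N * delannoy_term (n + 2) k) + ?B * (N * delannoy_term (n + 1) k)
          + ?C * (N * delannoy_term n k)"
      by (simp only: distrib_left ac_simps)
    also have "\<dots> = u * (?A * ((1 - Q * q * z) * (1 - Q * q\<^sup>2 * z) / z\<^sup>2)
        + ?B * ((1 - Q * q\<^sup>2 / z) * (1 - Q * q * z) / z)
        + ?C * ((1 - Q * q / z) * (1 - Q * q\<^sup>2 / z)))"
      unfolding terms by (simp only: distrib_left ac_simps times_divide_eq_right)
    also have "\<dots> = u * (\<alpha> / (q * z)\<^sup>2 * ((z / Q) * (1 - Q * q\<^sup>2 / z) * (1 - Q * q * z))
        - \<alpha> / z\<^sup>2 * (1 - z)\<^sup>2)"
      unfolding certificate_identity[OF q_nonzero \<open>Q \<noteq> 0\<close> \<open>z \<noteq> 0\<close>] \<alpha>_def ..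
    also have "\<dots> = \<alpha> / (q * z)\<^sup>2 * (u * (z / Q) * (1 - Q * q\<^sup>2 / z) * (1 - Q * q * z))
        - \<alpha> / z\<^sup>2 * (1 - z)\<^sup>2 * u"
      by (simp only: right_diff_distrib ac_simps)
    also have "\<dots> = G (Suc k) - G k"
      using common_term_Suc[where n=n and k=k and 'k='k, folded Q_def z_def u_def, symmetric]
      by (simp add: G_def z_def u_def mult.assoc)
    finally show ?thesis .
  qed
  have "G (n + 3) = 0"
    using q_binomial_eq_0[of "n + 2" "n + 3", where 'a='k]
    by (simp add: G_def common_term_def add.commute[of 2])
  moreover have "G 0 = 0" by (simp add: G_def)
  ultimately have telescope: "(\<Sum>k<n + 3. G (Suc k) - G k) = 0"
    by (simp add: sum_lessThan_telescope)
  have D: "q_delannoy (n + 2) = (\<Sum>k<n + 3. delannoy_term (n + 2) k)"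
    "q_delannoy (n + 1) = (\<Sum>k<n + 3. delannoy_term (n + 1) k)"
    "q_delannoy n = (\<Sum>k<n + 3. delannoy_term n k)"
    by (rule q_delannoy_eq_sum_terms; simp)+
  have "N * (?A * q_delannoy (n + 2) + ?B * q_delannoy (n + 1) + ?C * q_delannoy n)
      = (\<Sum>k<n + 3. G (Suc k) - G k)"
    unfolding D step[symmetric] by (simp only: sum_distrib_left sum.distrib distrib_left)
  with telescope \<open>N \<noteq> 0\<close> show ?thesis by simp
qed

section \<open>Summation by parts\<close>

text \<open>This is \<open>(LF)(n) = 0\<close> without its powers of \<open>\<epsilon>\<close>: since \<open>\<epsilon>\<^sup>2 = 1\<close>, every term of \<open>(LF)(n)\<close>
  carries the same factor \<open>\<epsilon>\<^sup>n\<close>.\<close>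

lemma delannoy_op_annihilates:
  "q powi (- int n) * (1 + q powi (int n + 1)) * q_int (int n + 2) * q_delannoy (n + 2)
    + (q + q powi (int n + 2) + q powi (2 * int n + 4) + 3 * q powi (int n + 3))
        * q_int (- 2 * int n - 3) * q_delannoy (n + 1)
    + q powi (- int n) * (1 + q powi (int n + 2)) * q_int (int n + 1) * q_delannoy n
    = (0 :: 'k::field_char_0 poly fract)"
    (is "?lhs = 0")
proof -
  define Q where "Q = (q :: 'k poly fract) ^ n"
  have Q: "Q \<noteq> 0" by (simp add: Q_def)
  define c where "c = Q\<^sup>2 * q ^ 3 * (1 - q)"
  have "c \<noteq> 0" using Q one_minus_q_nonzero[where 'k='k] by (simp add: c_def)
  have p: "q powi (- int n) = 1 / Q" "q powi (int n + 1) = Q * q" "q powi (int n + 2) = Q * q\<^sup>2"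
    "q powi (int n + 3) = Q * q ^ 3" "q powi (2 * int n + 4) = Q\<^sup>2 * q ^ 4"
    by (simp_all add: Q_def power_int_add power_int_minus field_simps power_int_mult)
  have "q powi (- 2 * int n - 3) = inverse (q powi (2 * int n + 3) :: 'k poly fract)"
    by (simp flip: power_int_minus)
  also have "\<dots> = 1 / (Q\<^sup>2 * q ^ 3)"
    by (simp add: Q_def power_int_add power_int_mult field_simps)
  finally have p': "q powi (- 2 * int n - 3) = 1 / (Q\<^sup>2 * q ^ 3)" .
  have "c * ?lhs = Q * q ^ 3 * (1 + Q * q) * (1 - Q * q\<^sup>2) * q_delannoy (n + 2)
      + (q + Q * q\<^sup>2 + Q\<^sup>2 * q ^ 4 + 3 * Q * q ^ 3) * (Q\<^sup>2 * q ^ 3 - 1) * q_delannoy (n + 1)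
      + Q * q ^ 3 * (1 + Q * q\<^sup>2) * (1 - Q * q) * q_delannoy n"
    unfolding q_int_def p p' c_def using Q one_minus_q_nonzero[where 'k='k]
    by (simp add: divide_simps) algebra
  also have "\<dots> = 0"
    unfolding Q_def by (rule q_delannoy_recurrence)
  finally show ?thesis using \<open>c \<noteq> 0\<close> by simp
qed

text \<open>In this form, shifted by one, the recurrence extends to \<open>n = 0\<close>: there the last coefficient
  contains \<open>[0]\<close>, so the truncated index \<open>n - 1\<close> is harmless, and the claim is a
  relation between \<open>D\<^sub>0 = 1\<close> and \<open>D\<^sub>1 = 2 + 1/q\<close>. This lets the summation start from the empty sum.\<close>

lemma delannoy_op_annihilates_pred:
  "q powi (1 - int n) * (1 + q powi int n) * q_int (int n + 1) * q_delannoy (n + 1)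
    + (q + q powi (int n + 1) + q powi (2 * int n + 2) + 3 * q powi (int n + 2))
        * q_int (- 2 * int n - 1) * q_delannoy n
    + q powi (1 - int n) * (1 + q powi (int n + 1)) * q_int (int n) * q_delannoy (n - 1)
    = (0 :: 'k::field_char_0 poly fract)"
proof (cases n)
  case 0
  have "1 - q \<noteq> (0 :: 'k poly fract)" by (rule one_minus_q_nonzero)
  have "q_delannoy 0 = (1 :: 'k poly fract)"
    by (simp add: q_delannoy_def q_binomial_def choose_two)
  moreover have "q_delannoy 1 = (2 + 1 / q :: 'k poly fract)"
    using \<open>1 - q \<noteq> (0 :: 'k poly fract)\<close>
    by (simp add: q_delannoy_def q_binomial_def q_int_def power_int_minus choose_two divide_simps) algebra
  ultimately show ?thesis
    using \<open>1 - q \<noteq> (0 :: 'k poly fract)\<close>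
    by (simp add: 0 q_int_def power_int_minus divide_simps) algebra
next
  case (Suc m)
  show ?thesis
    using delannoy_op_annihilates[of m, where 'k='k] by (simp add: Suc add_ac minus_diff_commute)
qed

lemma adjoint_delannoy_op:
  "adjoint (delannoy_op \<epsilon>) P k =
     q powi (- k) * (1 + q powi (k + 2)) * q_int (k + 1) * P k
     + \<epsilon> * (q + q powi (k + 1) + q powi (2 * k + 2) + 3 * q powi (k + 2))
         * q_int (- 2 * k - 1) * P (k - 1)
     + q powi (2 - k) * (1 + q powi (k - 1)) * q_int k * P (k - 2)"
  by (simp add: adjoint_def delannoy_op_def lessThan_Suc eval_nat_numeral algebra_simps minus_diff_commute)

text \<open>When \<open>n\<close> increases by one, the terms with \<open>P n\<close> and \<open>P (n - 2)\<close> match those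
  of the new summand directly, and the terms with \<open>P (n - 1)\<close> cancel by the recurrence.\<close>

lemma sum_adjoint_delannoy_op:
  fixes \<epsilon> :: "'k::field_char_0 poly fract"
  assumes "\<epsilon>\<^sup>2 = 1"
  shows "(\<Sum>k<n. adjoint (delannoy_op \<epsilon>) P (int k) * \<epsilon> ^ k * q_delannoy k) =
    \<epsilon> ^ n * q_int (int n) * q powi (1 - int n) *
      ((1 + q powi (int n + 1)) * P (int n - 1) * \<epsilon> * q_delannoy (n - 1)
       - q * (1 + q powi (int n - 1)) * P (int n - 2) * q_delannoy n)"
proof (induction n)
  case 0
  show ?case by (simp add: q_int_def)
next
  case (Suc n)
  \<comment> \<open>\<open>a\<close>, \<open>b\<close> and \<open>d\<close> come from the coefficients of \<open>\<sigma>\<^sup>0\<close>, \<open>\<sigma>\<close> and \<open>\<sigma>\<^sup>2\<close> in the new summand; \<open>c\<close> and \<open>c'\<close> are the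
    coefficients of the boundary terms with \<open>P (n - 1)\<close> after and before the step.\<close>
  define a where "a = q powi (- int n) * (1 + q powi (int n + 2)) * q_int (int n + 1 :: int) * P (int n)"
  define b where "b = (q + q powi (int n + 1) + q powi (2 * int n + 2) + 3 * q powi (int n + 2))
    * (q_int (- 2 * int n - 1) :: 'k poly fract)"
  define c c' where "c = q powi (1 - int n) * (1 + q powi int n) * (q_int (int n + 1) :: 'k poly fract)"
    and "c' = q powi (1 - int n) * (1 + q powi (int n + 1)) * (q_int (int n) :: 'k poly fract)"
  define d where "d = q powi (2 - int n) * (1 + q powi (int n - 1)) * (q_int (int n) :: 'k poly fract)"
  have shift: "q powi (1 - int n) = q * (q powi (- int n) :: 'k poly fract)"
    "q powi (2 - int n) = q * (q powi (1 - int n) :: 'k poly fract)"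
    by (simp_all add: power_int_diff power_int_minus field_simps power2_eq_square)
  have rec: "c * q_delannoy (n + 1) + b * q_delannoy n + c' * q_delannoy (n - 1) = 0"
    unfolding b_def c_def c'_def by (rule delannoy_op_annihilates_pred)
  have adj: "adjoint (delannoy_op \<epsilon>) P (int n) = a + \<epsilon> * b * P (int n - 1) + d * P (int n - 2)"
    unfolding adjoint_delannoy_op a_def b_def d_def by (simp only: ac_simps)
  have "(\<Sum>k<Suc n. adjoint (delannoy_op \<epsilon>) P (int k) * \<epsilon> ^ k * q_delannoy k)
      = \<epsilon> ^ n * (c' * P (int n - 1) * \<epsilon> * q_delannoy (n - 1) - d * P (int n - 2) * q_delannoy n)
        + (a + \<epsilon> * b * P (int n - 1) + d * P (int n - 2)) * \<epsilon> ^ n * q_delannoy n"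
    unfolding sum.lessThan_Suc Suc adj c'_def d_def shift(2) by (simp only: algebra_simps)
  also have "\<dots> = \<epsilon> ^ n * (a * q_delannoy n
      + \<epsilon> * P (int n - 1) * (b * q_delannoy n + c' * q_delannoy (n - 1)))"
    by (simp add: algebra_simps)
  also have "\<dots> = \<epsilon> ^ n * (\<epsilon> * \<epsilon> * a * q_delannoy n - \<epsilon> * P (int n - 1) * (c * q_delannoy (n + 1)))"
    using rec assms by (simp add: power2_eq_square) algebra
  also have "\<dots> = \<epsilon> ^ Suc n * (a * \<epsilon> * q_delannoy n - c * P (int n - 1) * q_delannoy (Suc n))"
    by (simp add: algebra_simps)
  also have "\<dots> = \<epsilon> ^ Suc n * q_int (int (Suc n)) * q powi (1 - int (Suc n)) *
      ((1 + q powi (int (Suc n) + 1)) * P (int (Suc n) - 1) * \<epsilon> * q_delannoy (Suc n - 1)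
       - q * (1 + q powi (int (Suc n) - 1)) * P (int (Suc n) - 2) * q_delannoy (Suc n))"
    unfolding a_def c_def shift(1) by (simp add: algebra_simps)
  finally show ?case .
qed

theorem theorem6:
  fixes \<epsilon> :: "'k::field_char_0 poly fract"
    and p :: "'k poly fract laurent_poly"
    and P :: "int \<Rightarrow> 'k poly fract"
    and n :: nat
  assumes "\<epsilon> \<in> {1, - 1}"
    and "n > 0"
    and "\<And>k. P k = laurent_eval p (q powi k)"
  shows "(\<Sum>k=0..n - 1. adjoint (delannoy_op \<epsilon>) P (int k) * \<epsilon> ^ k * q_delannoy k) =
    \<epsilon> ^ n * q_int (int n) * q powi (1 - int n) *
      ((1 + q powi (int n + 1)) * P (int n - 1) * \<epsilon> * q_delannoy (n - 1)
       - q * (1 + q powi (int n - 1)) * P (int n - 2) * q_delannoy n)"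
proof -
  have "{0..n - 1} = {..<n}" using \<open>n > 0\<close> by auto
  moreover have "\<epsilon>\<^sup>2 = 1" using assms(1) by auto
  ultimately show ?thesis by (simp only: sum_adjoint_delannoy_op)
qed

end
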